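(* Let $\mathcal{A}$ be a central hyperplane arrangement in $\mathbb{C}^2$ consisting of $n$ distinct non-degenerate lines $H_1,\dots,H_n$ through the origin with positive integer multiplicities $m_1,\dots,m_n$. For each $i$ let $\theta_i\in\mathbb{C}/2\pi\mathbb{Z}$ be the unique element such that the normal vectors of $H_i$ are multiples of $(\cos(\theta_i/2),\sin(\theta_i/2))$. Let $E(\mathcal{A})$ be the collection of particles at positions $(\theta_1,\dots,\theta_n)$ with charges $(q_1,\dots,q_n)=(m_1(m_1+1),\dots,m_n(m_n+1))$. Then the following are equivalent: (1) $\mathcal{A}$ is a first-locus configuration; (2) $E(\mathcal{A})$ is in equilibrium for the charged trigonometric Calogero-Moser potential $\mu$; (3) $E(\mathcal{A})$ is a critical point of the potential $\mu$.
   Context: $\langle\cdot,\cdot\rangle$ denotes the standard $\mathbb{C}$-bilinear (not Hermitian) inner product on $\mathbb{C}^2$. For each line $H_i$ choose a normal vector $\alpha_i$, so $H_i=\{x:\langle\alpha_i,x\rangle=0\}$. Non-degenerate means $\langle\alpha_i,\alpha_i\rangle\neq0$. (Although $(\cos(\theta/2),\sin(\theta/2))$ is defined only up to sign for $\theta\in\mathbb{C}/2\pi\mathbb{Z}$, its span is well defined.) First-locus configuration: $\mathcal{A}$ is a first-locus configuration if for every $i$, $$\sum_{j\neq i}\frac{m_j(m_j+1)\langle\alpha_j,\alpha_j\rangle\langle\alpha_j,\alpha_i\rangle}{\langle\alpha_j,x\rangle^{3}}=0$$ for all $x\in H_i$ at which the expression is defined (i.e. $x\notin H_j$ for $j\ne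 i$). This condition does not depend on the choice of the $\alpha_i$. Charged trigonometric Calogero-Moser potential: for fixed positive integer charges $(q_1,\dots,q_n)$ and distinct points $E=(\theta_1,\dots,\theta_n)$ in $\mathbb{C}/2\pi\mathbb{Z}$, $$\mu(E)=\sum_{i\neq j}\frac{q_iq_j}{\sin^2\left(\frac{\theta_j-\theta_i}{2}\right)},$$ the sum being over ordered pairs $1\le i,j\le n$, $i\neq j$. The force on the particle at $\theta_i$ is $\frac{\partial\mu}{\partial\theta_i}(E)$ (up to convention of constants), and $E$ is in equilibrium if $\frac{\partial\mu}{\partial\theta_i}(E)=0$ for all $i$; $E$ is a critical point of $\mu$ if the differential of $\mu$, as a function of $(\theta_1,\dots,\theta_n)$ with charges fixed, vanishes at $E$. *)

theory Defs
  imports "HOL-Analysis.Analysis"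
begin

section \<open>Lines in the complex plane \<open>\<complex>\<^sup>2\<close>\<close>

text \<open>The bilinear form, without complex conjugation.\<close>

definition cdot :: "complex ^ 2 \<Rightarrow> complex ^ 2 \<Rightarrow> complex" where
  "cdot x y = (\<Sum>k\<in>UNIV. x $ k * y $ k)"

definition is_normal :: "complex ^ 2 \<Rightarrow> (complex ^ 2) set \<Rightarrow> bool" where
  "is_normal \<alpha> L \<longleftrightarrow> \<alpha> \<noteq> 0 \<and> L = {x. cdot \<alpha> x = 0}"

definition central_line :: "(complex ^ 2) set \<Rightarrow> bool" where
  "central_line L \<longleftrightarrow> (\<exists>\<alpha>. is_normal \<alpha> L)"

definition nondegenerate :: "(complex ^ 2) set \<Rightarrow> bool" where
  "nondegenerate L \<longleftrightarrow> (\<forall>\<alpha>. is_normal \<alpha> L \<longrightarrow> cdot \<alpha> \<alpha> \<noteq> 0)"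

text \<open>
  The condition does not depend on the choice of the normal vectors: replacing each
  \<open>\<alpha> j\<close> by \<open>c j * \<alpha> j\<close> multiplies the \<open>i\<close>-th sum by \<open>c i\<close>.  It is required for all choices.
\<close>

definition first_locus :: "('n::finite \<Rightarrow> (complex ^ 2) set) \<Rightarrow> ('n \<Rightarrow> nat) \<Rightarrow> bool" where
  "first_locus H m \<longleftrightarrow>
    (\<forall>\<alpha>. (\<forall>i. is_normal (\<alpha> i) (H i)) \<longrightarrow>
      (\<forall>i. \<forall>x\<in>H i. (\<forall>j. j \<noteq> i \<longrightarrow> x \<notin> H j) \<longrightarrow>
        (\<Sum>j\<in>UNIV - {i}. of_nat (m j * (m j + 1)) * cdot (\<alpha> j) (\<alpha> j) * cdot (\<alpha> j) (\<alpha> i)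
            / cdot (\<alpha> j) x ^ 3) = 0))"

section \<open>Angles\<close>

definition angle_rel :: "complex \<Rightarrow> complex \<Rightarrow> bool" where
  "angle_rel r s \<longleftrightarrow> (\<exists>k::int. r = s + of_real (2 * pi * of_int k))"

text \<open>The group \<open>\<complex> / 2\<pi>\<int>\<close>, with projection \<open>abs_angle\<close>.\<close>

quotient_type angle = complex / angle_rel
proof (rule equivpI)
  show "reflp angle_rel"
    by (auto simp: reflp_def angle_rel_def intro!: exI[of _ 0])
  show "symp angle_rel"
    unfolding symp_def angle_rel_def
  proof clarify
    fix y :: complex and k :: int
    show "\<exists>l::int. y = y + of_real (2 * pi * of_int k) + of_real (2 * pi * of_int l)"
      by (rule exI[of _ "- k"]) simp
  qed
  show "transp angle_rel"
    unfolding transp_def angle_rel_def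
  proof clarify
    fix z :: complex and k l :: int
    show "\<exists>j::int. z + of_real (2 * pi * of_int l) + of_real (2 * pi * of_int k)
        = z + of_real (2 * pi * of_int j)"
      by (rule exI[of _ "k + l"]) (simp add: algebra_simps)
  qed
qed

lemma sin_cos_half_shift:
  fixes s :: complex and k :: int
  obtains e :: complex where "e = 1 \<or> e = -1"
    "sin ((s + of_real (2 * pi * of_int k)) / 2) = e * sin (s / 2)"
    "cos ((s + of_real (2 * pi * of_int k)) / 2) = e * cos (s / 2)"
proof -
  define p :: complex where "p = of_real (pi * of_int k)"
  have p: "(s + of_real (2 * pi * of_int k)) / 2 = s / 2 + p"
    by (simp add: p_def add_divide_distrib)
  have s0: "sin p = 0"
    unfolding p_def sin_of_real by (simp add: mult.commute sin_zero_iff_int2)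
  have "cos p ^ 2 = 1"
    using sin_cos_squared_add[of p] s0 by simp
  then have "cos p = 1 \<or> cos p = -1"
    by (simp add: power2_eq_1_iff)
  then show thesis
    by (rule that) (simp_all only: p sin_add cos_add s0, simp_all)
qed

text \<open>
  The line spanned by \<open>(cos (\<theta> / 2), sin (\<theta> / 2))\<close>, which is determined by \<open>\<theta>\<close> modulo \<open>2\<pi>\<close>
  although the vector is determined only up to sign.
\<close>

lift_definition normal_span :: "angle \<Rightarrow> (complex ^ 2) set"
  is "\<lambda>r. vec.span {vector [cos (r / 2), sin (r / 2)]}"
proof -
  fix r s assume "angle_rel r s"
  then obtain k :: int where k: "r = s + of_real (2 * pi * of_int k)"
    by (auto simp: angle_rel_def)
  obtain e :: complex where e: "e = 1 \<or> e = -1"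
    "sin (r / 2) = e * sin (s / 2)" "cos (r / 2) = e * cos (s / 2)"
    using sin_cos_half_shift[of s k] unfolding k by metis
  have "vector [cos (r / 2), sin (r / 2)] = e *s (vector [cos (s / 2), sin (s / 2)] :: complex ^ 2)"
    by (simp add: vec_eq_iff forall_2 e)
  moreover have "e \<noteq> 0" using e(1) by auto
  ultimately show "vec.span {vector [cos (r / 2), sin (r / 2)] :: complex ^ 2}
      = vec.span {vector [cos (s / 2), sin (s / 2)]}"
    using vec.span_image_scale[of "{vector [cos (s / 2), sin (s / 2)] :: complex ^ 2}" "\<lambda>_. e"]
    by simp
qed

definition line_angle :: "(complex ^ 2) set \<Rightarrow> angle" where
  "line_angle L = (THE t. \<forall>\<alpha>. is_normal \<alpha> L \<longrightarrow> \<alpha> \<in> normal_span t)"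

lemma line_angle_ex1:
  assumes "central_line L" "nondegenerate L"
  shows "\<exists>!t. \<forall>\<alpha>. is_normal \<alpha> L \<longrightarrow> \<alpha> \<in> normal_span t"
proof -
  obtain \<alpha> where \<alpha>: "is_normal \<alpha> L"
    using assms(1) by (auto simp: central_line_def)
  have nz: "(\<alpha> $ 1)\<^sup>2 + (\<alpha> $ 2)\<^sup>2 \<noteq> 0"
    using assms(2) \<alpha> by (auto simp: nondegenerate_def cdot_def sum_2 power2_eq_square)
  define d where "d = csqrt ((\<alpha> $ 1)\<^sup>2 + (\<alpha> $ 2)\<^sup>2)"
  have d2: "d\<^sup>2 = (\<alpha> $ 1)\<^sup>2 + (\<alpha> $ 2)\<^sup>2" by (simp add: d_def)
  have d: "d \<noteq> 0" using d2 nz by auto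
  define a b where "a = \<alpha> $ 1 / d" and "b = \<alpha> $ 2 / d"
  have "a\<^sup>2 + b\<^sup>2 = 1"
    using d d2 nz by (simp add: a_def b_def power_divide flip: add_divide_distrib)
  then have prod: "(a + \<i> * b) * (a - \<i> * b) = 1"
    by (simp add: algebra_simps power2_eq_square)
  then have abnz: "a + \<i> * b \<noteq> 0" by auto
  define w where "w = - \<i> * Ln (a + \<i> * b)"
  have e1: "exp (\<i> * w) = a + \<i> * b"
    using abnz by (simp add: w_def)
  have e2: "exp (- (\<i> * w)) = a - \<i> * b"
    using prod abnz by (simp add: exp_minus e1 field_simps)
  have cw: "cos w = a" and sw: "sin w = b"
    by (simp_all add: cos_exp_eq sin_exp_eq e1 e2)
  have span: "normal_span (abs_angle r) = range (\<lambda>c. c *s vector [cos (r / 2), sin (r / 2)])" for r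
    by (simp add: normal_span.abs_eq vec.span_singleton)
  have \<alpha>w: "\<alpha> = d *s vector [cos w, sin w]"
    using d by (simp add: vec_eq_iff forall_2 cw sw a_def b_def)
  show ?thesis
  proof (rule ex1I[of _ "abs_angle (2 * w)"], intro allI impI)
    fix \<beta> assume "is_normal \<beta> L"
    moreover have "vector [- \<alpha> $ 2, \<alpha> $ 1] \<in> L"
      using \<alpha> by (simp add: is_normal_def cdot_def sum_2)
    ultimately have "\<beta> $ 1 * \<alpha> $ 2 = \<beta> $ 2 * \<alpha> $ 1"
      by (simp add: is_normal_def cdot_def sum_2)
    then have "\<beta> $ 1 * d\<^sup>2 = cdot \<beta> \<alpha> * \<alpha> $ 1" "\<beta> $ 2 * d\<^sup>2 = cdot \<beta> \<alpha> * \<alpha> $ 2"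
      unfolding d2 cdot_def sum_2 by algebra+
    then have "\<beta> = (cdot \<beta> \<alpha> / d\<^sup>2) *s \<alpha>"
      using d by (simp add: vec_eq_iff forall_2 field_simps)
    then have "\<beta> = (cdot \<beta> \<alpha> / d\<^sup>2 * d) *s vector [cos w, sin w]"
      by (subst (asm) (2) \<alpha>w) (simp add: vector_smult_assoc)
    then show "\<beta> \<in> normal_span (abs_angle (2 * w))"
      by (auto simp: span)
  next
    fix t assume t: "\<forall>\<alpha>. is_normal \<alpha> L \<longrightarrow> \<alpha> \<in> normal_span t"
    obtain r where r: "t = abs_angle r"
      by (metis Quotient_abs_rep[OF Quotient_angle])
    obtain c where c: "\<alpha> = c *s vector [cos (r / 2), sin (r / 2)]"
      using t \<alpha> unfolding r span by auto
    have "c \<noteq> 0" using c \<alpha> by (auto simp: is_normal_def)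
    have q: "d * cos w = c * cos (r / 2)" "d * sin w = c * sin (r / 2)"
      using c unfolding \<alpha>w by (simp_all add: vec_eq_iff forall_2)
    have "c * d * sin (r / 2 - w) = 0"
      unfolding sin_diff using q by algebra
    then have "sin (r / 2 - w) = 0" using \<open>c \<noteq> 0\<close> d by simp
    then obtain k :: int where "r / 2 - w = of_real (of_int k * pi)"
      by (auto simp: sin_eq_0)
    then have "r = 2 * w + of_real (2 * pi * of_int k)"
      by (simp add: field_simps)
    then show "t = abs_angle (2 * w)"
      unfolding r angle.abs_eq_iff angle_rel_def by blast
  qed
qed

section \<open>The charged trigonometric Calogero-Moser potential\<close>

lift_definition sin2_half_diff :: "angle \<Rightarrow> angle \<Rightarrow> complex"
  is "\<lambda>r s. (sin ((s - r) / 2))\<^sup>2"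
proof -
  fix r r' s s' assume "angle_rel r r'" "angle_rel s s'"
  then obtain k l :: int
    where kl: "r = r' + of_real (2 * pi * of_int k)" "s = s' + of_real (2 * pi * of_int l)"
    by (auto simp: angle_rel_def)
  have eq: "s - r = (s' - r') + of_real (2 * pi * of_int (l - k))"
    by (simp add: kl algebra_simps)
  show "(sin ((s - r) / 2))\<^sup>2 = (sin ((s' - r') / 2))\<^sup>2"
    unfolding eq by (rule sin_cos_half_shift[of "s' - r'" "l - k"]) auto
qed

text \<open>
  Meaningful only for pairwise distinct positions, i.e. injective \<open>E\<close>; coinciding particles would
  contribute \<open>1 / 0 = 0\<close>.
\<close>

definition potential :: "('n::finite \<Rightarrow> nat) \<Rightarrow> ('n \<Rightarrow> angle) \<Rightarrow> complex" where
  "potential q E =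
    (\<Sum>(i, j) | i \<noteq> j. of_nat (q i * q j) / sin2_half_diff (E i) (E j))"

text \<open>
  Derivatives on \<open>\<complex> / 2\<pi>\<int>\<close> are taken in the local coordinates given by the projection
  \<open>abs_angle\<close>; by periodicity the choice of lift does not matter.
\<close>

definition has_force :: "('n::finite \<Rightarrow> nat) \<Rightarrow> ('n \<Rightarrow> angle) \<Rightarrow> 'n \<Rightarrow> complex \<Rightarrow> bool" where
  "has_force q E i F \<longleftrightarrow>
    (\<forall>w. abs_angle w = E i \<longrightarrow>
      ((\<lambda>z. potential q (E(i := abs_angle z))) has_field_derivative F) (at w))"

definition in_equilibrium :: "('n::finite \<Rightarrow> nat) \<Rightarrow> ('n \<Rightarrow> angle) \<Rightarrow> bool" where
  "in_equilibrium q E \<longleftrightarrow> (\<forall>i. has_force q E i 0)"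

text \<open>
  \<open>has_derivative\<close> is the real Frechet derivative on \<open>\<complex>\<^sup>n\<close>; the differential vanishes as a
  real-linear map iff it vanishes as a complex-linear one.
\<close>

definition critical_point :: "('n::finite \<Rightarrow> nat) \<Rightarrow> ('n \<Rightarrow> angle) \<Rightarrow> bool" where
  "critical_point q E \<longleftrightarrow>
    (\<forall>w :: complex ^ 'n. (\<forall>i. abs_angle (w $ i) = E i) \<longrightarrow>
      ((\<lambda>z :: complex ^ 'n. potential q (\<lambda>i. abs_angle (z $ i))) has_derivative (\<lambda>_. 0)) (at w))"

section \<open>The charged particles of an arrangement\<close>

definition particle_positions :: "('n \<Rightarrow> (complex ^ 2) set) \<Rightarrow> 'n \<Rightarrow> angle" where
  "particle_positions H i = line_angle (H i)"

definition particle_charges :: "('n \<Rightarrow> nat) \<Rightarrow> 'n \<Rightarrow> nat" where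
  "particle_charges m i = m i * (m i + 1)"

end

(* Write the normal of H i as a multiple of (cos w, sin w) with w = theta_i / 2.  Then H i is spanned
   by (- sin w, cos w), and evaluated there the i-th first-locus sum is, up to a nonzero factor,
     S_i = sum over j of q_j cos ((theta_j - theta_i) / 2) / sin ((theta_j - theta_i) / 2) ^ 3.
   Since 1 / sin^2 has derivative - 2 cos / sin^3, the differential of the potential has
   coefficients 2 q_i S_i.  So all three conditions say that every S_i vanishes. *)
theory Submission
  imports Defs
begin

section \<open>Unit normals and tangents attached to an angle\<close>

definition unit_normal :: "complex \<Rightarrow> complex ^ 2" where
  "unit_normal r = vector [cos (r / 2), sin (r / 2)]"

definition unit_tangent :: "complex \<Rightarrow> complex ^ 2" where
  "unit_tangent r = vector [- sin (r / 2), cos (r / 2)]"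

text \<open>Taken on complex lifts of the angles, so that sine and cosine apply directly. Moving a
  lift by 2 pi multiplies the sine and the cosine by the same sign, which cancels in each
  quotient.\<close>

definition charge_force :: "('n::finite \<Rightarrow> nat) \<Rightarrow> ('n \<Rightarrow> complex) \<Rightarrow> 'n \<Rightarrow> complex" where
  "charge_force q r i =
    (\<Sum>j\<in>UNIV - {i}. of_nat (q j) * cos ((r j - r i) / 2) / sin ((r j - r i) / 2) ^ 3)"

lemma abs_rep_angle: "abs_angle (rep_angle t) = t"
  by (rule Quotient_abs_rep[OF Quotient_angle])

lemma cdot_scale_left: "cdot (c *s x) y = c * cdot x y"
  by (simp add: cdot_def sum_2 algebra_simps)

lemma cdot_scale_right: "cdot x (c *s y) = c * cdot x y"
  by (simp add: cdot_def sum_2 algebra_simps)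

lemma cdot_unit_normal: "cdot (unit_normal s) (unit_normal r) = cos ((s - r) / 2)"
  by (simp add: cdot_def sum_2 unit_normal_def cos_diff diff_divide_distrib)

lemma cdot_unit_normal_tangent: "cdot (unit_normal s) (unit_tangent r) = sin ((s - r) / 2)"
  by (simp add: cdot_def sum_2 unit_normal_def unit_tangent_def sin_diff diff_divide_distrib)

lemma unit_normal_nonzero: "unit_normal r \<noteq> 0"
  using cdot_unit_normal[of r r] by (auto simp: cdot_def)

text \<open>The Pythagorean identity, valid for complex angles, makes the unit normal and tangent an
  orthonormal basis for \<open>cdot\<close>; the witness is the coefficient
  \<open>cdot x (unit_tangent r)\<close>.\<close>

lemma orthogonal_unit_normal:
  assumes "cdot (unit_normal r) x = 0"
  obtains t where "x = t *s unit_tangent r"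
proof -
  have sc: "(sin (r / 2))\<^sup>2 + (cos (r / 2))\<^sup>2 = 1" by simp
  have orth: "cos (r / 2) * x $ 1 + sin (r / 2) * x $ 2 = 0"
    using assms by (simp add: cdot_def sum_2 unit_normal_def)
  have "x = (cos (r / 2) * x $ 2 - sin (r / 2) * x $ 1) *s unit_tangent r"
    unfolding vec_eq_iff forall_2 unit_tangent_def using sc orth
    by (simp del: sin_cos_squared_add sin_cos_squared_add2) algebra
  then show thesis by (rule that)
qed

lemma normal_span_abs_angle: "normal_span (abs_angle r) = range (\<lambda>c. c *s unit_normal r)"
  by (simp add: normal_span.abs_eq vec.span_singleton unit_normal_def)

section \<open>Lines and their angles\<close>

lemma is_normal_scale:
  assumes "c \<noteq> 0" "is_normal (c *s x) L"
  shows "is_normal x L"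
  using assms by (auto simp: is_normal_def cdot_scale_left)

lemma is_normal_line_angle:
  assumes "central_line L" "nondegenerate L" "line_angle L = abs_angle r" "is_normal \<alpha> L"
  obtains c where "c \<noteq> 0" "\<alpha> = c *s unit_normal r"
proof -
  \<comment> \<open>\<open>line_angle\<close> is a definite description; unique existence gives
    access to its defining property.\<close>
  have "\<alpha> \<in> normal_span (line_angle L)"
    using theI'[OF line_angle_ex1[OF assms(1,2)]] assms(4) by (simp add: line_angle_def)
  then obtain c where c: "\<alpha> = c *s unit_normal r"
    by (auto simp: assms(3) normal_span_abs_angle)
  moreover have "c \<noteq> 0" using c assms(4) by (auto simp: is_normal_def)
  ultimately show thesis by (rule that[rotated])
qed

lemma is_normal_unit_normal:
  assumes "central_line L" "nondegenerate L" "line_angle L = abs_angle r"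
  shows "is_normal (unit_normal r) L"
proof -
  obtain \<alpha> where \<alpha>: "is_normal \<alpha> L"
    using assms(1) by (auto simp: central_line_def)
  then show ?thesis
    using is_normal_line_angle[OF assms \<alpha>] is_normal_scale by metis
qed

text \<open>A lift of the common angle yields one unit normal shared by both lines, and a normal
  determines its line. Hence distinct lines become distinct particles.\<close>

lemma line_angle_inj:
  assumes "central_line L" "nondegenerate L" "central_line L'" "nondegenerate L'"
    and "line_angle L = line_angle L'"
  shows "L = L'"
proof -
  obtain r where r: "line_angle L = abs_angle r"
    by (metis abs_rep_angle)
  show ?thesis
    using is_normal_unit_normal[OF assms(1,2) r] is_normal_unit_normal[OF assms(3,4)] assms(5) r
    by (simp add: is_normal_def)
qed

text \<open>Zeros of the complex sine are the integer multiples of pi. In contrapositive form this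
  keeps the denominators nonzero at distinct positions.\<close>

lemma sin_half_diff_eq_0_imp_abs_angle_eq:
  assumes "sin ((s - r) / 2) = 0"
  shows "abs_angle s = abs_angle r"
proof -
  obtain k :: int where "(s - r) / 2 = of_real (of_int k * pi)"
    using assms by (auto simp: sin_eq_0)
  then have "s = r + of_real (2 * pi * of_int k)"
    by (simp add: field_simps)
  then show ?thesis
    unfolding angle.abs_eq_iff angle_rel_def by blast
qed

section \<open>The first-locus condition in terms of angles\<close>

lemma first_locus_sum_unit_tangent:
  fixes c r :: "'n::finite \<Rightarrow> complex"
  assumes "\<And>j. c j \<noteq> 0"
  defines "\<alpha> \<equiv> \<lambda>j. c j *s unit_normal (r j)"
  shows "(\<Sum>j\<in>UNIV - {i}. of_nat (q j) * cdot (\<alpha> j) (\<alpha> j) * cdot (\<alpha> j) (\<alpha> i)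
      / cdot (\<alpha> j) (t *s unit_tangent (r i)) ^ 3) = c i / t ^ 3 * charge_force q r i"
  unfolding charge_force_def sum_distrib_left
proof (rule sum.cong[OF refl])
  fix j
  show "of_nat (q j) * cdot (\<alpha> j) (\<alpha> j) * cdot (\<alpha> j) (\<alpha> i)
      / cdot (\<alpha> j) (t *s unit_tangent (r i)) ^ 3
    = c i / t ^ 3 * (of_nat (q j) * cos ((r j - r i) / 2) / sin ((r j - r i) / 2) ^ 3)"
    \<comment> \<open>The three factors \<open>c j\<close> of the numerator cancel the cube in the
      denominator, leaving \<open>c i / t ^ 3\<close>. For t = 0 both sides are 0, by the convention
      for division by zero.\<close>
    using assms(1)[of j]
    by (simp add: \<alpha>_def cdot_scale_left cdot_scale_right cdot_unit_normal
        cdot_unit_normal_tangent power_mult_distrib power3_eq_cube ac_simps)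
qed

text \<open>Forwards, test the condition on the unit normals at the unit tangent. Backwards, every
  normal is a multiple of the unit normal and every point of \<open>H i\<close> a multiple of the
  unit tangent, so each sum is a multiple of \<open>charge_force\<close>.\<close>

lemma first_locus_iff_charge_force:
  fixes H :: "'n::finite \<Rightarrow> (complex ^ 2) set" and r :: "'n \<Rightarrow> complex"
  assumes H: "\<And>i. central_line (H i)" "\<And>i. nondegenerate (H i)" "inj H"
    and r: "\<And>i. line_angle (H i) = abs_angle (r i)"
  shows "first_locus H m \<longleftrightarrow> (\<forall>i. charge_force (particle_charges m) r i = 0)"
proof
  assume fl: "first_locus H m"
  have N: "is_normal (unit_normal (r j)) (H j)" for j
    by (rule is_normal_unit_normal[OF H(1,2) r])
  show "\<forall>i. charge_force (particle_charges m) r i = 0"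
  proof
    fix i
    have mem: "unit_tangent (r i) \<in> H j \<longleftrightarrow> sin ((r j - r i) / 2) = 0" for j
      using N[of j] by (simp add: is_normal_def cdot_unit_normal_tangent)
    \<comment> \<open>The test point must avoid the other lines: lying on \<open>H j\<close> would
      force equal angles, hence equal lines.\<close>
    have "unit_tangent (r i) \<notin> H j" if "j \<noteq> i" for j
    proof
      assume "unit_tangent (r i) \<in> H j"
      then have "line_angle (H j) = line_angle (H i)"
        using mem sin_half_diff_eq_0_imp_abs_angle_eq r by simp
      then show False
        using line_angle_inj[OF H(1,2) H(1,2)] injD[OF H(3)] that by blast
    qed
    moreover have "unit_tangent (r i) \<in> H i" by (simp add: mem)
    ultimately have "(\<Sum>j\<in>UNIV - {i}. of_nat (particle_charges m j)
        * cdot (unit_normal (r j)) (unit_normal (r j)) * cdot (unit_normal (r j)) (unit_normal (r i))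
        / cdot (unit_normal (r j)) (unit_tangent (r i)) ^ 3) = 0"
      using fl[unfolded first_locus_def, rule_format, of "\<lambda>j. unit_normal (r j)" "unit_tangent (r i)" i] N
      unfolding particle_charges_def by blast
    then show "charge_force (particle_charges m) r i = 0"
      using first_locus_sum_unit_tangent[of "\<lambda>_. 1" "particle_charges m" r i 1] by simp
  qed
next
  assume cf: "\<forall>i. charge_force (particle_charges m) r i = 0"
  show "first_locus H m"
    unfolding first_locus_def
  proof (intro allI impI ballI)
    fix \<alpha> i x
    assume \<alpha>: "\<forall>i. is_normal (\<alpha> i) (H i)" and x: "x \<in> H i"
    have "\<exists>c. c \<noteq> 0 \<and> \<alpha> j = c *s unit_normal (r j)" for j
      using is_normal_line_angle[OF H(1,2) r] \<alpha> by metis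
    then obtain c where c: "\<And>j. c j \<noteq> 0" "\<And>j. \<alpha> j = c j *s unit_normal (r j)"
      by metis
    have "cdot (unit_normal (r i)) x = 0"
      using is_normal_unit_normal[OF H(1,2) r, of i] x by (simp add: is_normal_def)
    then obtain t where t: "x = t *s unit_tangent (r i)"
      by (rule orthogonal_unit_normal)
    show "(\<Sum>j\<in>UNIV - {i}. of_nat (m j * (m j + 1)) * cdot (\<alpha> j) (\<alpha> j) * cdot (\<alpha> j) (\<alpha> i)
        / cdot (\<alpha> j) x ^ 3) = 0"
      using first_locus_sum_unit_tangent[OF c(1), where q = "particle_charges m" and r = r
          and i = i and t = t] cf
      by (simp add: c(2) t particle_charges_def)
  qed
qed

section \<open>The differential of the potential\<close>

lemma sum_pairs_neq:
  fixes f :: "'n::finite \<Rightarrow> 'n \<Rightarrow> 'a::comm_monoid_add"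
  shows "(\<Sum>(i, j) | i \<noteq> j. f i j) = (\<Sum>i\<in>UNIV. \<Sum>j\<in>UNIV - {i}. f i j)"
proof -
  have "{(i, j). i \<noteq> j} = (SIGMA i:UNIV. UNIV - {i :: 'n})" by auto
  then show ?thesis by (simp add: sum.Sigma)
qed

text \<open>Swapping the indices turns the \<open>h j\<close> half of the sum into the
  \<open>h i\<close> half, antisymmetry absorbing the minus sign; hence the factor 2. This collects
  the coefficient of each coordinate in the differential.\<close>

lemma sum_pairs_antisym:
  fixes f :: "'n::finite \<Rightarrow> 'n \<Rightarrow> 'a::comm_ring_1"
  assumes "\<And>i j. f j i = - f i j"
  shows "(\<Sum>(i, j) | i \<noteq> j. f i j * (h i - h j))
    = (\<Sum>i\<in>UNIV. 2 * (\<Sum>j\<in>UNIV - {i}. f i j) * h i)"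
proof -
  have "f i j * (h i - h j) = f i j * h i + f j i * h j" for i j
    by (simp add: assms[where i = i and j = j] algebra_simps)
  then have "(\<Sum>(i, j) | i \<noteq> j. f i j * (h i - h j))
      = (\<Sum>(i, j) | i \<noteq> j. f i j * h i) + (\<Sum>(i, j) | i \<noteq> j. f j i * h j)"
    by (simp add: sum.distrib split_def)
  also have "(\<Sum>(i, j) | i \<noteq> j. f j i * h j) = (\<Sum>(i, j) | i \<noteq> j. f i j * h i)"
    by (rule sum.reindex_bij_witness[of _ prod.swap prod.swap]) auto
  finally have "(\<Sum>(i, j) | i \<noteq> j. f i j * (h i - h j)) = 2 * (\<Sum>(i, j) | i \<noteq> j. f i j * h i)"
    by simp
  then show ?thesis
    by (simp add: sum_pairs_neq sum_distrib_right sum_distrib_left mult.assoc)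
qed

text \<open>Chain rule in u = \<open>z $ j - z $ i\<close>: the 2 from the square cancels the half
  inside the sine, and the minus sign goes into the order of \<open>h $ i - h $ j\<close>.\<close>

lemma has_derivative_inverse_sin_squared:
  fixes z :: "complex ^ 'n::finite"
  assumes "sin ((z $ j - z $ i) / 2) \<noteq> 0"
  shows "((\<lambda>z. a / (sin ((z $ j - z $ i) / 2))\<^sup>2) has_derivative
    (\<lambda>h. a * cos ((z $ j - z $ i) / 2) / sin ((z $ j - z $ i) / 2) ^ 3 * (h $ i - h $ j))) (at z)"
proof -
  let ?u = "z $ j - z $ i"
  have "((\<lambda>u. a / (sin (u / 2))\<^sup>2) has_field_derivative
      - a * cos (?u / 2) / sin (?u / 2) ^ 3) (at ?u)"
    using assms
    by (auto intro!: derivative_eq_intros simp: divide_simps power2_eq_square power3_eq_cube)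
  moreover have "((\<lambda>z. z $ j - z $ i) has_derivative (\<lambda>h. h $ j - h $ i)) (at z)"
    by (intro has_derivative_diff bounded_linear_imp_has_derivative bounded_linear_vec_nth)
  ultimately have "((\<lambda>z. a / (sin ((z $ j - z $ i) / 2))\<^sup>2) has_derivative
      (\<lambda>h. - a * cos (?u / 2) / sin (?u / 2) ^ 3 * (h $ j - h $ i))) (at z)"
    unfolding has_field_derivative_def by (rule has_derivative_compose[rotated])
  then show ?thesis
    by (rule has_derivative_eq_rhs) (simp add: fun_eq_iff right_diff_distrib)
qed

text \<open>Differentiate term by term. The coefficients are antisymmetric because cosine is even
  and the cube of sine is odd, so the contributions of (i, j) and (j, i) add up.\<close>

lemma potential_has_derivative:
  fixes z :: "complex ^ 'n::finite"
  assumes "inj (\<lambda>i. abs_angle (z $ i))"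
  shows "((\<lambda>z. potential q (\<lambda>i. abs_angle (z $ i))) has_derivative
    (\<lambda>h. \<Sum>i\<in>UNIV. 2 * of_nat (q i) * charge_force q (($) z) i * h $ i)) (at z)"
proof -
  define f where "f i j = of_nat (q i * q j) * cos ((z $ j - z $ i) / 2)
    / sin ((z $ j - z $ i) / 2) ^ 3" for i j
  have nz: "sin ((z $ j - z $ i) / 2) \<noteq> 0" if "i \<noteq> j" for i j
    using sin_half_diff_eq_0_imp_abs_angle_eq injD[OF assms] that by metis
  have antisym: "f j i = - f i j" for i j
  proof -
    have "(z $ j - z $ i) / 2 = - ((z $ i - z $ j) / 2)" by (simp add: field_simps)
    then show ?thesis by (simp only: f_def sin_minus cos_minus) (simp add: mult.commute)
  qed
  have row: "2 * (\<Sum>j\<in>UNIV - {i}. f i j) = 2 * of_nat (q i) * charge_force q (($) z) i" for i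
    by (simp add: f_def charge_force_def sum_distrib_left mult.assoc)
  have "((\<lambda>z. potential q (\<lambda>i. abs_angle (z $ i))) has_derivative
    (\<lambda>h. \<Sum>(i, j) | i \<noteq> j. f i j * (h $ i - h $ j))) (at z)"
    unfolding potential_def sin2_half_diff.abs_eq f_def split_def
    by (intro has_derivative_sum has_derivative_inverse_sin_squared nz) auto
  then show ?thesis
    unfolding sum_pairs_antisym[where f = f, OF antisym] row .
qed

section \<open>Critical points and equilibrium\<close>

lemma sum_axis: "(\<Sum>j\<in>UNIV. a j * axis i c $ j) = a i * (c :: 'a::comm_ring_1)"
  by (simp add: axis_def if_distrib[of "\<lambda>x. _ * x"] cong: if_cong)

text \<open>By uniqueness of the derivative, the differential vanishes iff its coefficients do;
  evaluating at \<open>axis i 1\<close> isolates the i-th one, and positive charges can be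
  cancelled.\<close>

lemma critical_point_iff_charge_force:
  fixes E :: "'n::finite \<Rightarrow> angle"
  assumes "inj E" and q: "\<And>i. q i > 0"
  shows "critical_point q E \<longleftrightarrow>
    (\<forall>r. (\<forall>i. abs_angle (r i) = E i) \<longrightarrow> (\<forall>i. charge_force q r i = 0))"
proof -
  have *: "((\<lambda>z :: complex ^ 'n. potential q (\<lambda>i. abs_angle (z $ i))) has_derivative (\<lambda>_. 0)) (at w)
      \<longleftrightarrow> (\<forall>i. charge_force q (($) w) i = 0)"
    if "\<forall>i. abs_angle (w $ i) = E i" for w
  proof -
    have D: "((\<lambda>z. potential q (\<lambda>i. abs_angle (z $ i))) has_derivative
        (\<lambda>h. \<Sum>i\<in>UNIV. 2 * of_nat (q i) * charge_force q (($) w) i * h $ i)) (at w)"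
      by (rule potential_has_derivative) (use that \<open>inj E\<close> in simp)
    show ?thesis
    proof
      assume "((\<lambda>z. potential q (\<lambda>i. abs_angle (z $ i))) has_derivative (\<lambda>_. 0)) (at w)"
      then have 0: "(\<Sum>i\<in>UNIV. 2 * of_nat (q i) * charge_force q (($) w) i * h $ i) = 0" for h
        by (rule has_derivative_unique[OF D, THEN fun_cong])
      show "\<forall>i. charge_force q (($) w) i = 0"
      proof
        fix i
        show "charge_force q (($) w) i = 0"
          using 0[of "axis i 1"] q[of i] unfolding sum_axis by simp
      qed
    next
      assume "\<forall>i. charge_force q (($) w) i = 0"
      then show "((\<lambda>z. potential q (\<lambda>i. abs_angle (z $ i))) has_derivative (\<lambda>_. 0)) (at w)"
        using D by simp
    qed
  qed
  show ?thesis
    unfolding critical_point_def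
  proof (intro iffI allI impI)
    fix r i
    assume "\<forall>w. (\<forall>i. abs_angle (w $ i) = E i) \<longrightarrow>
        ((\<lambda>z. potential q (\<lambda>i. abs_angle (z $ i))) has_derivative (\<lambda>_. 0)) (at w)"
      and "\<forall>i. abs_angle (r i) = E i"
    moreover have "($) (\<chi> i. r i) = r" by (simp add: fun_eq_iff)
    ultimately show "charge_force q r i = 0"
      using *[of "\<chi> i. r i"] by simp
  qed (simp add: *)
qed

lemma has_force_charge_force:
  fixes E :: "'n::finite \<Rightarrow> angle"
  assumes "inj E" and r: "\<And>j. abs_angle (r j) = E j"
  shows "((\<lambda>z. potential q (E(i := abs_angle z))) has_field_derivative
    2 * of_nat (q i) * charge_force q r i) (at (r i))"
proof -
  \<comment> \<open>The coordinate line through the lift \<open>r\<close>, with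
    \<open>g (r i)\<close> = \<open>r\<close>. Composing the potential with it moves only the i-th
    particle, so the force follows from the full differential by the chain rule.\<close>
  define g where "g z = (\<chi> j. r j) + axis i (z - r i)" for z
  have g: "(\<lambda>j. abs_angle (g z $ j)) = E(i := abs_angle z)" for z
    by (simp add: g_def axis_def r fun_eq_iff)
  have gr: "($) (g (r i)) = r"
    by (simp add: g_def axis_def fun_eq_iff)
  have "linear (axis i :: complex \<Rightarrow> complex ^ 'n)"
    by (intro linearI) (auto simp: axis_def vec_eq_iff)
  then have "bounded_linear (axis i :: complex \<Rightarrow> complex ^ 'n)"
    by (rule linear_conv_bounded_linear[THEN iffD1])
  moreover have "((\<lambda>z. z - r i) has_derivative (\<lambda>h. h)) (at (r i))"
    by (auto intro!: derivative_eq_intros)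
  ultimately have "((\<lambda>z. axis i (z - r i) :: complex ^ 'n) has_derivative axis i) (at (r i))"
    by (rule bounded_linear.has_derivative)
  from has_derivative_add[OF has_derivative_const this] have dg: "(g has_derivative axis i) (at (r i))"
    unfolding g_def by simp
  have "((\<lambda>z. potential q (\<lambda>j. abs_angle (z $ j))) has_derivative
    (\<lambda>h. \<Sum>j\<in>UNIV. 2 * of_nat (q j) * charge_force q (($) (g (r i))) j * h $ j)) (at (g (r i)))"
    by (rule potential_has_derivative) (use \<open>inj E\<close> in \<open>simp add: g r\<close>)
  from has_derivative_compose[OF dg this] show ?thesis
    unfolding g sum_axis by (simp add: has_field_derivative_def gr)
qed

lemma in_equilibrium_iff_charge_force:
  assumes "inj E" and q: "\<And>i. q i > 0"
  shows "in_equilibrium q E \<longleftrightarrow>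
    (\<forall>r. (\<forall>i. abs_angle (r i) = E i) \<longrightarrow> (\<forall>i. charge_force q r i = 0))"
proof (intro iffI allI impI)
  fix r i
  assume "in_equilibrium q E" and r: "\<forall>i. abs_angle (r i) = E i"
  then have "((\<lambda>z. potential q (E(i := abs_angle z))) has_field_derivative 0) (at (r i))"
    by (auto simp: in_equilibrium_def has_force_def)
  then have "2 * of_nat (q i) * charge_force q r i = 0"
    using has_force_charge_force[OF \<open>inj E\<close>] r DERIV_unique by metis
  then show "charge_force q r i = 0" using q[of i] by simp
next
  assume cf: "\<forall>r. (\<forall>i. abs_angle (r i) = E i) \<longrightarrow> (\<forall>i. charge_force q r i = 0)"
  obtain s where s: "\<And>j. abs_angle (s j) = E j"
    by (rule that[of "\<lambda>j. rep_angle (E j)"]) (rule abs_rep_angle)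
  show "in_equilibrium q E"
    unfolding in_equilibrium_def has_force_def
  proof (intro allI impI)
    fix i w
    assume w: "abs_angle w = E i"
    \<comment> \<open>\<open>has_force\<close> ranges over all lifts \<open>w\<close> of the i-th
      position; the other particles keep the fixed lifts \<open>s\<close>.\<close>
    define r where "r = s(i := w)"
    have r: "abs_angle (r j) = E j" for j
      by (simp add: r_def s w)
    then show "((\<lambda>z. potential q (E(i := abs_angle z))) has_field_derivative 0) (at w)"
      using has_force_charge_force[OF \<open>inj E\<close> r, of q i] cf by (simp add: r_def)
  qed
qed

theorem theorem4p1:
  fixes H :: "'n::finite \<Rightarrow> (complex ^ 2) set" and m :: "'n \<Rightarrow> nat"
  assumes "\<And>i. central_line (H i)"
    and "\<And>i. nondegenerate (H i)"
    and "inj H"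
    and "\<And>i. m i > 0"
  shows "(first_locus H m \<longleftrightarrow> in_equilibrium (particle_charges m) (particle_positions H)) \<and>
    (in_equilibrium (particle_charges m) (particle_positions H) \<longleftrightarrow>
      critical_point (particle_charges m) (particle_positions H))"
proof -
  let ?q = "particle_charges m" and ?E = "particle_positions H"
  have inj: "inj ?E"
    using line_angle_inj[OF assms(1,2) assms(1,2)] \<open>inj H\<close>
    by (auto simp: inj_def particle_positions_def)
  have q: "?q i > 0" for i
    using assms(4)[of i] by (simp add: particle_charges_def)
  obtain s where s: "\<And>j. abs_angle (s j) = ?E j"
    by (rule that[of "\<lambda>j. rep_angle (?E j)"]) (rule abs_rep_angle)
  have "first_locus H m \<longleftrightarrow> (\<forall>i. charge_force ?q r i = 0)" if "\<forall>i. abs_angle (r i) = ?E i" for r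
    using that by (intro first_locus_iff_charge_force assms) (simp add: particle_positions_def)
  \<comment> \<open>The equivalence holds for each lift, and the lift \<open>s\<close> ensures that
    the quantification over lifts is not vacuous.\<close>
  then have "first_locus H m \<longleftrightarrow>
      (\<forall>r. (\<forall>i. abs_angle (r i) = ?E i) \<longrightarrow> (\<forall>i. charge_force ?q r i = 0))"
    using s by blast
  then show ?thesis
    using in_equilibrium_iff_charge_force[OF inj q] critical_point_iff_charge_force[OF inj q] by simp
qed

end
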